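(* Let $(X_n)_{n\ge0}$ be the two-armed bandit algorithm with $p_A=p_B=1$ and steps $\gamma_n=\Delta_n/S_n$, where $\Delta_0=1$, $\Delta_n>0$ and $S_n=\sum_{k=0}^n\Delta_k$ (see the context), and let $X_\infty$ be the a.s. limit of $X_n$. Assume that the sequence $(\Delta_n)_{n\ge1}$ is bounded. (a) For every $x\in(0,1)$ there exists, under $\mathbb{P}_x$, an $(\mathcal F_n)$-martingale $(N_n)_{n\ge1}$ with bounded increments such that $$\sup_n\left|\log\left(\frac{X_n}{1-X_n}\right)-N_n\right|<+\infty,\qquad\mathbb{P}_x\text{-a.s.}$$ (b) Consequently, for every $x\in(0,1)$, $\mathbb{P}_x(X_\infty=0)=\mathbb{P}_x(X_\infty=1)=0$.
   Context: Two-armed bandit algorithm with $p_A=p_B=1$: let $(U_n)_{n\ge1}$ be i.i.d. random variables uniformly distributed on $[0,1]$; the steps satisfy $\gamma_n\in(0,1)$ and $\sum_n\gamma_n=+\infty$. The algorithm starting from $x\in[0,1]$ is defined by $X_0=x$ and, for $n\ge0$, $X_{n+1}=X_n+\gamma_{n+1}(\mathbf 1_{\{U_{n+1}\le X_n\}}-X_n)$ a.s. $\mathbb{P}_x$ denotes probability when $X_0=x$, and $\mathcal F_n=\sigma(U_1,\dots,U_n)$. The process is a $[0,1]$-valued martingale, hence converges a.s. to some $X_\infty$; if $x\in(0,1)$ then $X_n\in(0,1)$ for all $n$. The numbers $\Delta_n$ are defined from the steps by $\Delta_0:=1$ and $\Delta_n:=\gamma_n/\prod_{k=1}^n(1-\gamma_k)$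 for $n\ge1$; equivalently $\gamma_n=\Delta_n/S_n$ with $S_n:=\sum_{k=0}^n\Delta_k$. "Bounded increments" means that there is a finite deterministic constant $K$ (possibly depending on $x$) with $|N_{n+1}-N_n|\le K$ for all $n$, $\mathbb{P}_x$-a.s. *)

theory Defs
  imports "HOL-Probability.Probability"
begin

definition cumulative_weight :: "(nat \<Rightarrow> real) \<Rightarrow> nat \<Rightarrow> real" where
  "cumulative_weight \<Delta> n = (\<Sum>k\<le>n. \<Delta> k)"

definition bandit_step :: "(nat \<Rightarrow> real) \<Rightarrow> nat \<Rightarrow> real" where
  "bandit_step \<Delta> n = \<Delta> n / cumulative_weight \<Delta> n"

text \<open>Only the values \<open>\<gamma> n\<close> and \<open>U n\<close> with \<open>n \<ge> 1\<close> are used.\<close>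

primrec bandit :: "(nat \<Rightarrow> real) \<Rightarrow> (nat \<Rightarrow> 'a \<Rightarrow> real) \<Rightarrow> real \<Rightarrow> nat \<Rightarrow> 'a \<Rightarrow> real" where
  "bandit \<gamma> U x 0 = (\<lambda>\<omega>. x)"
| "bandit \<gamma> U x (Suc n) = (\<lambda>\<omega>. bandit \<gamma> U x n \<omega> +
      \<gamma> (Suc n) * ((if U (Suc n) \<omega> \<le> bandit \<gamma> U x n \<omega> then 1 else 0) - bandit \<gamma> U x n \<omega>))"

definition natural_filtration :: "'a measure \<Rightarrow> (nat \<Rightarrow> 'a \<Rightarrow> real) \<Rightarrow> nat \<Rightarrow> 'a measure" where
  "natural_filtration M U n =
     sigma (space M) (\<Union>k\<in>{1..n}. {U k -` A \<inter> space M |A. A \<in> sets borel})"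

text \<open>Discrete-time martingales with time set \<open>{m..}\<close>. The clauses \<open>filtration\<close> and
  \<open>subalgebra\<close> belong to the definition because \<open>real_cond_exp M F\<close> is a conditional expectation
  only if \<open>F\<close> is a sub-sigma-algebra of \<open>M\<close>.\<close>

definition martingale_from ::
    "'a measure \<Rightarrow> (nat \<Rightarrow> 'a measure) \<Rightarrow> nat \<Rightarrow> (nat \<Rightarrow> 'a \<Rightarrow> real) \<Rightarrow> bool" where
  "martingale_from M F m N \<longleftrightarrow>
     filtration (space M) F \<and>
     (\<forall>n\<ge>m. subalgebra M (F n) \<and>
        N n \<in> borel_measurable (F n) \<and>
        integrable M (N n) \<and>
        (AE \<omega> in M. real_cond_exp M (F n) (N (Suc n)) \<omega> = N n \<omega>))"

text \<open>The weights can be recovered from the steps: \<open>\<Delta> n = \<gamma> n / (\<Prod>k=1..n. 1 - \<gamma> k)\<close>.\<close>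

lemma weight_eq_step_div_prod:
  assumes "\<Delta> 0 = 1" and "\<And>n. n \<ge> 1 \<Longrightarrow> \<Delta> n > 0" and "n \<ge> 1"
  shows "bandit_step \<Delta> n \<in> {0<..<1}"
    and "\<Delta> n = bandit_step \<Delta> n / (\<Prod>k=1..n. 1 - bandit_step \<Delta> k)"
proof -
  have pos: "cumulative_weight \<Delta> m > 0" for m
    unfolding cumulative_weight_def
    by (rule sum_pos) (use assms in \<open>auto simp: Suc_le_eq, metis gr0I zero_less_one\<close>)
  have step: "cumulative_weight \<Delta> (Suc m) = cumulative_weight \<Delta> m + \<Delta> (Suc m)" for m
    by (simp add: cumulative_weight_def)
  have prod: "(\<Prod>k=1..m. 1 - bandit_step \<Delta> k) = 1 / cumulative_weight \<Delta> m" for m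
  proof (induction m)
    case 0
    show ?case using assms(1) by (simp add: cumulative_weight_def)
  next
    case (Suc m)
    have "1 - bandit_step \<Delta> (Suc m) = cumulative_weight \<Delta> m / cumulative_weight \<Delta> (Suc m)"
      using pos[of "Suc m"] by (simp add: bandit_step_def step field_simps)
    with Suc.IH show ?case using pos[of m] by simp
  qed
  obtain m where m: "n = Suc m" using assms(3) by (cases n) auto
  show "bandit_step \<Delta> n \<in> {0<..<1}"
    using pos[of n] pos[of m] assms(2)[OF assms(3)] by (simp add: bandit_step_def m step)
  show "\<Delta> n = bandit_step \<Delta> n / (\<Prod>k=1..n. 1 - bandit_step \<Delta> k)"
    using pos[of n] unfolding prod by (simp add: bandit_step_def)
qed

end

theory Submission imports Defs begin

text \<open>The weights \<open>Y n = S n * X n\<close> and \<open>Z n = S n * (1 - X n)\<close> of the two arms start at \<open>x\<close> and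
  \<open>1 - x\<close>, never decrease, and at each step exactly one of them grows by \<open>\<Delta> (Suc n)\<close>. So the log-odds
  \<open>ln (Y n / Z n)\<close> have bounded increments when the \<open>\<Delta> n\<close> are bounded by \<open>C\<close>, and the expansion
  \<open>ln (1 + u) = u + O(u\<^sup>2)\<close> bounds their conditional drift by
  \<open>C * \<Delta> (Suc n) / S n * (1 / Y n + 1 / Z n)\<close>. As \<open>\<Delta> (Suc n) / (S n * Y n)\<close> is the conditional
  expectation of \<open>(Y (Suc n) - Y n) / (Y n)\<^sup>2\<close>, whose sum is bounded by a telescoping argument, the drift
  is almost surely absolutely summable, and \<open>N\<close> is the martingale part of the Doob decomposition of
  the log-odds. A martingale with bounded increments almost surely tends neither to \<open>-\<infinity>\<close> nor to
  \<open>\<infinity>\<close>, which excludes the limits 0 and 1 of \<open>X\<close>.\<close>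

section \<open>Averaging over an independent uniform variable\<close>

text \<open>By independence the joint law of the identity, viewed as a map into \<open>F\<close>,
  and of \<open>V\<close> is a product, so Fubini's theorem integrates out \<open>V\<close> first; a
  uniform variable falls below a level in the unit interval with probability equal to that level.
  This is the conditional expectation of the indicator given \<open>F\<close>, in weak form.\<close>

lemma (in prob_space) integral_uniform_le:
  fixes V X D :: "'a \<Rightarrow> real"
  assumes F: "subalgebra M F"
    and [measurable]: "V \<in> borel_measurable M"
    and indep: "indep_set (sets F) {V -` A \<inter> space M |A. A \<in> sets borel}"
    and V: "distr M borel V = uniform_measure lborel {0..1}"
    and [measurable]: "X \<in> borel_measurable F" "D \<in> borel_measurable F"
    and X: "\<And>\<omega>. X \<omega> \<in> {0..1}" and D: "\<And>\<omega>. \<bar>D \<omega>\<bar> \<le> B"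
  shows "(\<integral>\<omega>. D \<omega> * of_bool (V \<omega> \<le> X \<omega>) \<partial>M) = (\<integral>\<omega>. D \<omega> * X \<omega> \<partial>M)"
proof -
  \<comment> \<open>Viewing the identity as a random element of \<open>F\<close> makes the
    \<open>F\<close>-measurable \<open>X\<close> and \<open>D\<close> functions of the first
    coordinate of a pair.\<close>
  have id[measurable]: "(\<lambda>\<omega>. \<omega>) \<in> M \<rightarrow>\<^sub>M F"
    by (rule measurable_from_subalg[OF F measurable_ident_sets[OF refl]])
  let ?P = "distr M F (\<lambda>\<omega>. \<omega>)" and ?Q = "distr M borel V"
  interpret P: prob_space ?P by (rule prob_space_distr) fact
  interpret Q: prob_space ?Q by (rule prob_space_distr) measurable
  interpret PQ: pair_prob_space ?P ?Q ..
  let ?g = "\<lambda>(\<omega>, u). D \<omega> * of_bool (u \<le> X \<omega>)"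
  have g: "?g \<in> borel_measurable (F \<Otimes>\<^sub>M borel)" by measurable
  \<comment> \<open>The bound on \<open>D\<close> holds on the whole type, so any point will do,
    here \<open>undefined\<close>.\<close>
  have B0: "0 \<le> B" using D[of undefined] by linarith
  have "AE z in ?P \<Otimes>\<^sub>M ?Q. norm (?g z) \<le> B"
    using D B0 by (auto simp: of_bool_def)
  moreover have "?g \<in> borel_measurable (?P \<Otimes>\<^sub>M ?Q)" using g by measurable
  ultimately have int: "integrable (?P \<Otimes>\<^sub>M ?Q) ?g"
    by (rule PQ.integrable_const_bound)
  have inner: "(\<integral>u. of_bool (u \<le> c) \<partial>?Q) = c" if "c \<in> {0..1}" for c :: real
  proof -
    have "(\<integral>u. of_bool (u \<le> c) \<partial>?Q) = (\<integral>u. indicator {..c} u \<partial>?Q)"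
      by (intro Bochner_Integration.integral_cong) (auto simp: indicator_def)
    also have "\<dots> = measure ?Q {..c}" by simp
    also have "\<dots> = measure lborel ({0..1} \<inter> {..c}) / measure lborel {0..1::real}"
      unfolding V by (subst measure_uniform_measure) auto
    also have "{0..1} \<inter> {..c} = {0..c}" using that by auto
    finally show ?thesis using that by simp
  qed
  have "(\<integral>\<omega>. D \<omega> * of_bool (V \<omega> \<le> X \<omega>) \<partial>M) = (\<integral>\<omega>. ?g (\<omega>, V \<omega>) \<partial>M)" by simp
  also have "\<dots> = (\<integral>z. ?g z \<partial>distr M (F \<Otimes>\<^sub>M borel) (\<lambda>\<omega>. (\<omega>, V \<omega>)))"
    by (rule integral_distr[symmetric]) (use g in measurable)
  \<comment> \<open>The two laws need only be compared on rectangles, where \<open>indep\<close>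
    applies directly.\<close>
  also have "distr M (F \<Otimes>\<^sub>M borel) (\<lambda>\<omega>. (\<omega>, V \<omega>)) = ?P \<Otimes>\<^sub>M ?Q"
  proof (rule pair_measure_eqI[symmetric])
    fix A C assume A: "A \<in> sets ?P" and C: "C \<in> sets ?Q"
    then have AM: "A \<in> events" using F by (auto simp: subalgebra_def)
    have "emeasure (distr M (F \<Otimes>\<^sub>M borel) (\<lambda>\<omega>. (\<omega>, V \<omega>))) (A \<times> C) = emeasure M (A \<inter> (V -` C \<inter> space M))"
      using A C sets.sets_into_space[OF AM]
      by (subst emeasure_distr) (auto intro!: arg_cong[where f="emeasure M"])
    also have "\<dots> = emeasure M A * emeasure M (V -` C \<inter> space M)"
    proof -
      have "prob (A \<inter> (V -` C \<inter> space M)) = prob A * prob (V -` C \<inter> space M)"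
        using A C by (intro indep_setD[OF indep]) auto
      then show ?thesis by (simp add: emeasure_eq_measure ennreal_mult)
    qed
    also have "\<dots> = emeasure ?P A * emeasure ?Q C"
      using A C sets.sets_into_space[OF AM]
      by (subst (1 2) emeasure_distr) (auto intro!: arg_cong2[where f="(*)"] arg_cong[where f="emeasure M"])
    finally show "emeasure ?P A * emeasure ?Q C = emeasure (distr M (F \<Otimes>\<^sub>M borel) (\<lambda>\<omega>. (\<omega>, V \<omega>))) (A \<times> C)" ..
  qed (auto intro: P.sigma_finite_measure_axioms Q.sigma_finite_measure_axioms)
  also have "(\<integral>z. ?g z \<partial>(?P \<Otimes>\<^sub>M ?Q)) = (\<integral>\<omega>. (\<integral>u. ?g (\<omega>, u) \<partial>?Q) \<partial>?P)"
    by (rule PQ.integral_fst'[OF int, symmetric])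
  also have "\<dots> = (\<integral>\<omega>. D \<omega> * X \<omega> \<partial>?P)"
    using inner[OF X] by simp
  also have "\<dots> = (\<integral>\<omega>. D \<omega> * X \<omega> \<partial>M)"
    by (rule integral_distr) measurable
  finally show ?thesis .
qed

section \<open>Martingales with bounded increments do not tend to infinity\<close>

text \<open>Lets a one-sided result about \<open>at_bot\<close> serve for \<open>at_top\<close> as
  well.\<close>

lemma martingale_from_uminus:
  assumes "prob_space M" "martingale_from M F m N"
  shows "martingale_from M F m (\<lambda>n \<omega>. - N n \<omega>)"
proof -
  interpret prob_space M by fact
  have "AE \<omega> in M. real_cond_exp M (F n) (\<lambda>\<omega>. - N (Suc n) \<omega>) \<omega> = - N n \<omega>" if "m \<le> n" for n
  proof -
    have int: "integrable M (N (Suc n))" and sub: "subalgebra M (F n)"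
      and N: "AE \<omega> in M. real_cond_exp M (F n) (N (Suc n)) \<omega> = N n \<omega>"
      using assms(2) that by (auto simp: martingale_from_def)
    interpret finite_measure_subalgebra M "F n" by unfold_locales fact
    show ?thesis using real_cond_exp_cmult[OF int, of "-1"] N by eventually_elim simp
  qed
  then show ?thesis using assms(2) by (auto simp: martingale_from_def)
qed

text \<open>The martingale stopped on reaching the level \<open>a\<close> is bounded above by an integrable variable,
  so by Fatou's lemma it cannot tend to \<open>-\<infinity>\<close> with positive probability.\<close>

lemma AE_not_martingale_at_bot:
  assumes "prob_space M" and mart: "martingale_from M F m N"
    and K: "AE \<omega> in M. \<forall>n\<ge>m. \<bar>N (Suc n) \<omega> - N n \<omega>\<bar> \<le> K"
  shows "AE \<omega> in M. \<not> filterlim (\<lambda>n. N n \<omega>) at_bot sequentially"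
proof -
  interpret prob_space M by fact
  have sub: "subalgebra M (F n)" and NF[measurable]: "N n \<in> borel_measurable (F n)"
    and int: "integrable M (N n)"
    and cond: "AE \<omega> in M. real_cond_exp M (F n) (N (Suc n)) \<omega> = N n \<omega>" if "m \<le> n" for n
    using mart that by (auto simp: martingale_from_def)
  have filt: "filtration (space M) F" using mart by (simp add: martingale_from_def)
  \<comment> \<open>A path tending to minus infinity is bounded above, hence stays below some
    natural number \<open>a\<close>; so countably many null sets suffice.\<close>
  have "AE \<omega> in M. \<not> (filterlim (\<lambda>n. N n \<omega>) at_bot sequentially \<and> (\<forall>k\<ge>m. N k \<omega> < real a))" for a :: nat
  proof -
    \<comment> \<open>\<open>D k\<close> is known at time \<open>k\<close>, so \<open>T\<close> is a
      martingale transform of \<open>N\<close>: it freezes at the first time from \<open>m\<close>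
      on at which \<open>N\<close> is at least \<open>a\<close>. For \<open>n \<le> m\<close> the
      sum is empty and \<open>T n\<close> is \<open>N m\<close>.\<close>
    define D where "D n \<omega> = (of_bool (\<forall>k\<in>{m..n}. N k \<omega> < real a) :: real)" for n \<omega>
    define T where "T n \<omega> = N m \<omega> + (\<Sum>k=m..<n. D k \<omega> * (N (Suc k) \<omega> - N k \<omega>))" for n \<omega>
    have mono: "N k \<in> borel_measurable (F n)" if "m \<le> k" "k \<le> n" for k n
    proof (rule measurable_from_subalg[OF _ NF[OF that(1)]])
      show "subalgebra (F n) (F k)"
        using filtration.space_F[OF filt] filtration.sets_F_mono[OF filt that(2)]
        by (simp add: subalgebra_def)
    qed
    have Dm: "D n \<in> borel_measurable (F n)" for n
      unfolding D_def using mono by (measurable, auto)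
    have int_D: "integrable M (\<lambda>\<omega>. D n \<omega> * N k \<omega>)" if "m \<le> n" "m \<le> k" for n k
    proof (rule Bochner_Integration.integrable_bound[OF int[OF that(2)]])
      have "D n \<in> borel_measurable M" using measurable_from_subalg[OF sub[OF that(1)] Dm] .
      moreover have "N k \<in> borel_measurable M" using int[OF that(2)] by auto
      ultimately show "(\<lambda>\<omega>. D n \<omega> * N k \<omega>) \<in> borel_measurable M" by measurable
    qed (auto simp: D_def)
    \<comment> \<open>\<open>D k\<close> is measurable for \<open>F k\<close>, so it passes through
      the conditional expectation of \<open>N (Suc k)\<close>.\<close>
    have zero: "(\<integral>\<omega>. D k \<omega> * (N (Suc k) \<omega> - N k \<omega>) \<partial>M) = 0" if k: "m \<le> k" for k
    proof -
      interpret finite_measure_subalgebra M "F k" by unfold_locales (rule sub[OF k])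
      have "(\<integral>\<omega>. D k \<omega> * N (Suc k) \<omega> \<partial>M) = (\<integral>\<omega>. D k \<omega> * real_cond_exp M (F k) (N (Suc k)) \<omega> \<partial>M)"
        using int[of "Suc k"] int_D[of k "Suc k"] Dm k by (intro real_cond_exp_intg(2)[symmetric]) auto
      also have "\<dots> = (\<integral>\<omega>. D k \<omega> * N k \<omega> \<partial>M)"
      proof (rule integral_cong_AE)
        have [measurable]: "D k \<in> borel_measurable M" "N k \<in> borel_measurable M"
          using measurable_from_subalg[OF sub[OF k] Dm] measurable_from_subalg[OF sub[OF k] NF[OF k]] .
        show "(\<lambda>\<omega>. D k \<omega> * N k \<omega>) \<in> borel_measurable M"
             "(\<lambda>\<omega>. D k \<omega> * real_cond_exp M (F k) (N (Suc k)) \<omega>) \<in> borel_measurable M" by measurable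
        show "AE \<omega> in M. D k \<omega> * real_cond_exp M (F k) (N (Suc k)) \<omega> = D k \<omega> * N k \<omega>"
          using cond[OF k] by eventually_elim simp
      qed
      finally show ?thesis
        using int_D[of k "Suc k"] int_D[of k k] k by (simp add: right_diff_distrib)
    qed
    have int_inc: "integrable M (\<lambda>\<omega>. D k \<omega> * (N (Suc k) \<omega> - N k \<omega>))" if "m \<le> k" for k
      using int_D[of k "Suc k"] int_D[of k k] that by (simp add: right_diff_distrib)
    have int_T: "integrable M (T n)" for n
      unfolding T_def using int_inc int by (intro Bochner_Integration.integrable_add Bochner_Integration.integrable_sum) auto
    have E_T: "(\<integral>\<omega>. T n \<omega> \<partial>M) = (\<integral>\<omega>. N m \<omega> \<partial>M)" for n
      unfolding T_def using int int_inc zero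
      by (subst Bochner_Integration.integral_add) (auto simp: Bochner_Integration.integral_sum)
    have T_eq: "T n \<omega> = N n \<omega>" if "\<forall>k\<in>{m..<n}. N k \<omega> < real a" "m \<le> n" for n \<omega>
    proof -
      have "T n \<omega> = N m \<omega> + (\<Sum>k=m..<n. N (Suc k) \<omega> - N k \<omega>)"
        unfolding T_def using that by (intro arg_cong2[where f="(+)"] sum.cong) (auto simp: D_def)
      then show ?thesis using sum_Suc_diff'[OF that(2), of "\<lambda>k. N k \<omega>"] by simp
    qed
    \<comment> \<open>Before freezing the values lie below \<open>a\<close>, and the freezing step
      overshoots by at most \<open>K\<close>; the summand with \<open>N m\<close> covers paths that
      already start at or above \<open>a\<close>.\<close>
    define c where "c \<omega> = real a + \<bar>N m \<omega>\<bar> + \<bar>K\<bar>" for \<omega>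
    have int_c: "integrable M c" unfolding c_def using int by auto
    have T_le: "T n \<omega> \<le> c \<omega>" if *: "\<forall>n\<ge>m. \<bar>N (Suc n) \<omega> - N n \<omega>\<bar> \<le> K" for n \<omega>
    proof (induction n)
      case 0
      then show ?case by (auto simp: T_def c_def)
    next
      case (Suc n)
      show ?case
      proof (cases "m \<le> n \<and> D n \<omega> = 1")
        case False
        then have "T (Suc n) \<omega> = T n \<omega>"
          by (auto simp: T_def D_def)
        then show ?thesis using Suc by simp
      next
        case True
        then have lt: "\<forall>k\<in>{m..n}. N k \<omega> < real a" by (auto simp: D_def)
        then have "T (Suc n) \<omega> = N (Suc n) \<omega>" using True by (intro T_eq) auto
        also have "\<dots> \<le> N n \<omega> + K" using * True by (auto simp: abs_le_iff algebra_simps)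
        finally show ?thesis using bspec[OF lt, of n] True by (simp add: c_def)
      qed
    qed
    have meas[measurable]: "(\<lambda>\<omega>. ennreal (c \<omega> - T n \<omega>)) \<in> borel_measurable M" for n
      using int_c int_T[of n] by measurable
    have fin: "(\<integral>\<^sup>+\<omega>. ennreal (c \<omega> - T n \<omega>) \<partial>M) = ennreal ((\<integral>\<omega>. c \<omega> \<partial>M) - (\<integral>\<omega>. N m \<omega> \<partial>M))" for n
    proof -
      have "AE \<omega> in M. 0 \<le> c \<omega> - T n \<omega>" using K by eventually_elim (use T_le in auto)
      then show ?thesis
        using int_c int_T[of n] by (subst nn_integral_eq_integral) (auto simp: E_T)
    qed
    \<comment> \<open>Fatou's lemma; the integrals agree for all \<open>n\<close> because
      \<open>T\<close> has constant expectation.\<close>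
    have "(\<integral>\<^sup>+\<omega>. liminf (\<lambda>n. ennreal (c \<omega> - T n \<omega>)) \<partial>M) \<le> ennreal ((\<integral>\<omega>. c \<omega> \<partial>M) - (\<integral>\<omega>. N m \<omega> \<partial>M))"
      using nn_integral_liminf[of "\<lambda>n \<omega>. ennreal (c \<omega> - T n \<omega>)" M] meas by (simp add: fin Liminf_const)
    then have "AE \<omega> in M. liminf (\<lambda>n. ennreal (c \<omega> - T n \<omega>)) \<noteq> \<infinity>"
      by (intro nn_integral_PInf_AE) (auto simp: top_unique)
    then show ?thesis
    proof eventually_elim
      case (elim \<omega>)
      show ?case
      proof
        assume *: "filterlim (\<lambda>n. N n \<omega>) at_bot sequentially \<and> (\<forall>k\<ge>m. N k \<omega> < real a)"
        have "filterlim (\<lambda>n. - N n \<omega>) at_top sequentially"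
          using * by (simp add: filterlim_uminus_at_bot)
        then have "filterlim (\<lambda>n. c \<omega> + (- N n \<omega>)) at_top sequentially"
          by (rule filterlim_tendsto_add_at_top[OF tendsto_const])
        moreover have "\<forall>\<^sub>F n in sequentially. c \<omega> + (- N n \<omega>) = c \<omega> - T n \<omega>"
          using eventually_ge_at_top[of m] by eventually_elim (use * T_eq in auto)
        ultimately have "filterlim (\<lambda>n. c \<omega> - T n \<omega>) at_top sequentially"
          by (rule filterlim_cong[OF refl refl, THEN iffD1, rotated])
        then have "(\<lambda>n. ennreal (c \<omega> - T n \<omega>)) \<longlonglongrightarrow> \<infinity>"
          by (simp add: ennreal_tendsto_top_eq_at_top)
        then have "liminf (\<lambda>n. ennreal (c \<omega> - T n \<omega>)) = \<infinity>"
          by (intro lim_imp_Liminf) auto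
        then show False using elim by simp
      qed
    qed
  qed
  then have "AE \<omega> in M. \<forall>a::nat. \<not> (filterlim (\<lambda>n. N n \<omega>) at_bot sequentially \<and> (\<forall>k\<ge>m. N k \<omega> < real a))"
    unfolding AE_all_countable ..
  then show ?thesis
  proof eventually_elim
    case (elim \<omega>)
    show ?case
    proof
      assume *: "filterlim (\<lambda>n. N n \<omega>) at_bot sequentially"
      then have "\<forall>\<^sub>F n in sequentially. N n \<omega> \<le> 0" by (auto simp: filterlim_at_bot)
      then obtain n0 where n0: "\<And>n. n \<ge> n0 \<Longrightarrow> N n \<omega> \<le> 0" by (auto simp: eventually_sequentially)
      \<comment> \<open>\<open>a\<close> exceeds 0, which bounds all values from \<open>n0\<close>
        on, and also the finitely many earlier values.\<close>
      obtain a :: nat where a: "Max (insert 0 ((\<lambda>n. N n \<omega>) ` {..n0})) < real a"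
        using reals_Archimedean2 by blast
      have "N n \<omega> < real a" for n
      proof (cases "n \<le> n0")
        case True
        then show ?thesis using a by auto
      next
        case False
        then show ?thesis using n0[of n] a by (auto intro: le_less_trans)
      qed
      then show False using elim * by blast
    qed
  qed
qed

section \<open>Elementary inequalities and a summability criterion\<close>

text \<open>For \<open>u > 1\<close> the left side is negative while the logarithm is nonnegative,
  so no smallness condition on the jumps arises later.\<close>

lemma ln_one_plus_lower_bound:
  fixes u :: real
  assumes "0 \<le> u"
  shows "u - u\<^sup>2 \<le> ln (1 + u)"
proof (cases "u \<le> 1")
  case True
  then show ?thesis using assms by (rule ln_one_plus_pos_lower_bound[rotated])
next
  case False
  then have "u - u\<^sup>2 \<le> 0" by (simp add: power2_eq_square)
  also have "0 \<le> ln (1 + u)" using assms by simp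
  finally show ?thesis .
qed

text \<open>With \<open>u = d / (s * p)\<close> the first-order term \<open>p * u = d / s\<close> is
  free of \<open>p\<close>, so it cancels between the two arms; the error \<open>p * u * u\<close>
  is at most \<open>C * (d / (s * (s * p)))\<close> since \<open>d \<le> C\<close>.\<close>

lemma scaled_ln_bounds:
  fixes p s d :: real
  assumes "0 < p" "0 < s" "0 \<le> d" "d \<le> C"
  shows "p * ln (1 + d / (s * p)) \<le> d / s"
    and "d / s - C * (d / (s * (s * p))) \<le> p * ln (1 + d / (s * p))"
proof -
  have u: "0 \<le> d / (s * p)" using assms by simp
  have "p * ln (1 + d / (s * p)) \<le> p * (d / (s * p))"
    using assms u by (intro mult_left_mono ln_add_one_self_le_self) auto
  then show "p * ln (1 + d / (s * p)) \<le> d / s" using assms by simp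
  have "d * d / (s * (s * p)) \<le> C * d / (s * (s * p))"
    using assms by (intro divide_right_mono mult_right_mono) auto
  then have "d / s - C * (d / (s * (s * p))) \<le> p * (d / (s * p) - (d / (s * p))\<^sup>2)"
    using assms by (simp add: power2_eq_square algebra_simps)
  also have "\<dots> \<le> p * ln (1 + d / (s * p))"
    using assms ln_one_plus_lower_bound[OF u] by (intro mult_left_mono) auto
  finally show "d / s - C * (d / (s * (s * p))) \<le> p * ln (1 + d / (s * p))" .
qed

text \<open>With \<open>y k * y (Suc k)\<close> as denominator the sum would telescope; replacing it
  by the square of \<open>y k\<close> costs the factor \<open>y (Suc k) / y k\<close>, at most
  \<open>1 + C / y 0\<close>.\<close>

lemma sum_increment_div_square_le:
  fixes y :: "nat \<Rightarrow> real"
  assumes y0: "0 < y 0" and mono: "\<And>n. y n \<le> y (Suc n)" and step: "\<And>n. y (Suc n) - y n \<le> C"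
  shows "(\<Sum>k<n. (y (Suc k) - y k) / (y k)\<^sup>2) \<le> (1 + C / y 0) / y 0"
proof -
  have ge: "y 0 \<le> y n" for n using lift_Suc_mono_le[of y, OF mono] by simp
  have C: "0 \<le> C" using mono[of 0] step[of 0] by linarith
  have "(y (Suc k) - y k) / (y k)\<^sup>2 \<le> (1 + C / y 0) * (1 / y k - 1 / y (Suc k))" for k
  proof -
    have pos: "0 < y k" "0 < y (Suc k)" using ge[of k] ge[of "Suc k"] y0 by auto
    have "y (Suc k) / y k \<le> 1 + C / y k" using step[of k] pos by (simp add: field_simps)
    also have "\<dots> \<le> 1 + C / y 0" using ge[of k] y0 C by (simp add: frac_le)
    finally have "(1 / y k - 1 / y (Suc k)) * (y (Suc k) / y k) \<le> (1 / y k - 1 / y (Suc k)) * (1 + C / y 0)"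
      using pos mono[of k] by (intro mult_left_mono) (auto simp: frac_le)
    moreover have "(1 / y k - 1 / y (Suc k)) * (y (Suc k) / y k) = (y (Suc k) - y k) / (y k)\<^sup>2"
      using pos by (simp add: field_simps power2_eq_square)
    ultimately show ?thesis by (simp add: mult.commute)
  qed
  then have "(\<Sum>k<n. (y (Suc k) - y k) / (y k)\<^sup>2) \<le> (\<Sum>k<n. (1 + C / y 0) * (1 / y k - 1 / y (Suc k)))"
    by (rule sum_mono)
  also have "\<dots> = (1 + C / y 0) * (1 / y 0 - 1 / y n)"
    using sum_lessThan_telescope'[of "\<lambda>k. 1 / y k" n] by (simp add: sum_distrib_left[symmetric])
  also have "\<dots> \<le> (1 + C / y 0) * (1 / y 0)"
    using y0 C ge[of n] by (intro mult_left_mono) auto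
  finally show ?thesis by simp
qed

text \<open>Monotone convergence makes the expectation of the whole series finite, so the series is
  finite almost everywhere.\<close>

lemma (in prob_space) AE_summable_if_integral_bounded:
  fixes f :: "nat \<Rightarrow> 'a \<Rightarrow> real"
  assumes int: "\<And>n. integrable M (f n)" and nonneg: "\<And>n \<omega>. 0 \<le> f n \<omega>"
    and bound: "\<And>n. (\<Sum>k<n. \<integral>\<omega>. f k \<omega> \<partial>M) \<le> c"
  shows "AE \<omega> in M. summable (\<lambda>n. f n \<omega>)"
proof -
  have [measurable]: "f n \<in> borel_measurable M" for n using int by auto
  have "(\<integral>\<^sup>+\<omega>. (\<Sum>n. ennreal (f n \<omega>)) \<partial>M) = (\<Sum>n. \<integral>\<^sup>+\<omega>. ennreal (f n \<omega>) \<partial>M)"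
    by (rule nn_integral_suminf) measurable
  also have "\<dots> = (\<Sum>n. ennreal (\<integral>\<omega>. f n \<omega> \<partial>M))"
    using int nonneg by (simp add: nn_integral_eq_integral)
  also have "\<dots> \<le> ennreal c"
    by (rule suminf_le_const) (use bound nonneg in \<open>auto simp: sum_ennreal intro: ennreal_leI\<close>)
  finally have "(\<integral>\<^sup>+\<omega>. (\<Sum>n. ennreal (f n \<omega>)) \<partial>M) \<noteq> \<infinity>" by (auto simp: top_unique)
  then have "AE \<omega> in M. (\<Sum>n. ennreal (f n \<omega>)) \<noteq> \<infinity>"
    by (rule nn_integral_PInf_AE[rotated]) measurable
  then show ?thesis
    by eventually_elim (use nonneg in \<open>auto intro: summable_suminf_not_top\<close>)
qed

lemma (in prob_space) bounded_integrable:
  fixes f :: "'a \<Rightarrow> real"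
  assumes "f \<in> borel_measurable M" "\<And>\<omega>. \<bar>f \<omega>\<bar> \<le> B"
  shows "integrable M f"
  using assms by (intro integrable_const_bound[of _ B]) auto

section \<open>The bandit process and the weights of its arms\<close>

locale two_armed_bandit = prob_space M for M :: "'a measure" +
  fixes U :: "nat \<Rightarrow> 'a \<Rightarrow> real" and \<Delta> :: "nat \<Rightarrow> real" and x C :: real
  assumes indep_U: "indep_vars (\<lambda>_. borel) U {1..}"
    and distr_U: "\<And>n. n \<ge> 1 \<Longrightarrow> distr M borel (U n) = uniform_measure lborel {0..1}"
    and weight_0: "\<Delta> 0 = 1"
    and weight_pos: "\<And>n. n \<ge> 1 \<Longrightarrow> \<Delta> n > 0"
    and weight_le: "\<And>n. n \<ge> 1 \<Longrightarrow> \<Delta> n \<le> C"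
    and start: "x \<in> {0<..<1}"
begin

abbreviation S where "S \<equiv> cumulative_weight \<Delta>"
abbreviation X where "X \<equiv> bandit (bandit_step \<Delta>) U x"
abbreviation F where "F \<equiv> natural_filtration M U"

text \<open>Indexed by the start of the step: it is measurable for \<open>F (Suc n)\<close>, and its
  conditional expectation given \<open>F n\<close> is \<open>X n\<close>.\<close>

definition up :: "nat \<Rightarrow> 'a \<Rightarrow> real" where
  "up n \<omega> = of_bool (U (Suc n) \<omega> \<le> X n \<omega>)"

lemma S_0: "S 0 = 1"
  by (simp add: cumulative_weight_def weight_0)

lemma S_Suc: "S (Suc n) = S n + \<Delta> (Suc n)"
  by (simp add: cumulative_weight_def)

lemma S_pos: "0 < S n"
  by (induction n) (auto simp: S_0 S_Suc weight_pos intro: add_pos_pos)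

lemma C_nonneg: "0 \<le> C"
  using weight_pos[of 1] weight_le[of 1] by simp

text \<open>The step times \<open>S (Suc n)\<close> is \<open>\<Delta> (Suc n)\<close>, and the
  growth of \<open>S\<close> absorbs the loss term of the recursion; multiplying by \<open>S\<close>
  thus makes it additive.\<close>

lemma S_X_Suc: "S (Suc n) * X (Suc n) \<omega> = S n * X n \<omega> + \<Delta> (Suc n) * up n \<omega>"
proof -
  have "S (Suc n) * bandit_step \<Delta> (Suc n) = \<Delta> (Suc n)"
    using S_pos[of "Suc n"] by (simp add: bandit_step_def)
  then have "S (Suc n) * X (Suc n) \<omega> = S (Suc n) * X n \<omega> + \<Delta> (Suc n) * (up n \<omega> - X n \<omega>)"
    by (simp add: up_def of_bool_def algebra_simps)
  then show ?thesis by (simp add: S_Suc algebra_simps)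
qed

lemma S_X_Suc': "S (Suc n) * (1 - X (Suc n) \<omega>) = S n * (1 - X n \<omega>) + \<Delta> (Suc n) * (1 - up n \<omega>)"
  using S_X_Suc[of n \<omega>] by (simp add: S_Suc algebra_simps)

text \<open>The additive recursion only adds nonnegative amounts. The resulting deterministic lower
  bound keeps the later quotients and logarithms bounded.\<close>

lemma S_X_ge: "x \<le> S n * X n \<omega>"
proof (induction n)
  case (Suc n)
  then show ?case using weight_pos[of "Suc n"] by (simp add: S_X_Suc up_def del: bandit.simps)
qed (simp add: S_0)

lemma S_X_ge': "1 - x \<le> S n * (1 - X n \<omega>)"
proof (induction n)
  case (Suc n)
  then show ?case using weight_pos[of "Suc n"] by (simp add: S_X_Suc' up_def del: bandit.simps)
qed (simp add: S_0)

lemma X_pos: "0 < X n \<omega>"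
  using S_X_ge[of n \<omega>] start S_pos[of n] by (metis greaterThanLessThan_iff less_le_trans zero_less_mult_pos)

lemma X_less_1: "X n \<omega> < 1"
proof -
  have "0 < 1 - X n \<omega>"
    using S_X_ge'[of n \<omega>] start S_pos[of n]
    by (metis diff_gt_0_iff_gt greaterThanLessThan_iff less_le_trans zero_less_mult_pos)
  then show ?thesis by simp
qed

section \<open>Filtration and measurability\<close>

lemma measurable_U: "n \<ge> 1 \<Longrightarrow> U n \<in> borel_measurable M"
  using indep_U by (auto simp: indep_vars_def)

lemma space_F: "space (F n) = space M"
  by (simp add: natural_filtration_def space_measure_of_conv)

lemma sets_F: "sets (F n) = sigma_sets (space M) (\<Union>k\<in>{1..n}. {U k -` A \<inter> space M |A. A \<in> sets borel})"
  unfolding natural_filtration_def by (rule sets_measure_of) auto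

lemma filtration_F: "filtration (space M) F"
  by unfold_locales (simp add: space_F, unfold sets_F, rule sigma_sets_mono', force)

lemma subalgebra_F: "subalgebra M (F n)"
  unfolding subalgebra_def space_F sets_F
  by (auto intro!: sets.sigma_sets_subset measurable_sets[OF measurable_U])

lemma F_mono: "m \<le> n \<Longrightarrow> f \<in> borel_measurable (F m) \<Longrightarrow> f \<in> borel_measurable (F n)"
  using filtration.sets_F_mono[OF filtration_F]
  by (intro measurable_from_subalg[of "F n" "F m"]) (auto simp: subalgebra_def space_F)

lemma measurable_U_F: "1 \<le> k \<Longrightarrow> k \<le> n \<Longrightarrow> U k \<in> borel_measurable (F n)"
  by (intro measurableI) (force simp: space_F sets_F intro!: sigma_sets.Basic)+

lemma measurable_X_F: "X n \<in> borel_measurable (F n)"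
proof (induction n)
  case (Suc n)
  have [measurable]: "X n \<in> borel_measurable (F (Suc n))" "U (Suc n) \<in> borel_measurable (F (Suc n))"
    using F_mono[OF _ Suc, of "Suc n"] measurable_U_F[of "Suc n" "Suc n"] by auto
  show ?case by simp
qed simp

lemma measurable_up_F: "up n \<in> borel_measurable (F (Suc n))"
proof -
  have [measurable]: "X n \<in> borel_measurable (F (Suc n))" "U (Suc n) \<in> borel_measurable (F (Suc n))"
    using F_mono[OF _ measurable_X_F, of n "Suc n"] measurable_U_F[of "Suc n" "Suc n"] by auto
  show ?thesis unfolding up_def by measurable
qed

lemma measurable_F_M: "f \<in> borel_measurable (F n) \<Longrightarrow> f \<in> borel_measurable M"
  by (rule measurable_from_subalg[OF subalgebra_F])

section \<open>Conditional law of the next choice, and summability for one arm\<close>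

text \<open>\<open>F n\<close> is generated by the index block \<open>{1..n}\<close>, disjoint from
  \<open>{Suc n}\<close>. Independent families stable under intersection stay independent when
  grouped into disjoint blocks.\<close>

lemma indep_F_U: "indep_set (sets (F n)) {U (Suc n) -` A \<inter> space M |A. A \<in> sets borel}"
proof -
  let ?E = "\<lambda>i. {U i -` A \<inter> space M |A. A \<in> sets borel}"
  let ?I = "case_bool {1..n} {Suc n}"
  have "indep_sets (\<lambda>j. sigma_sets (space M) (\<Union>i\<in>?I j. ?E i)) UNIV"
  proof (rule indep_sets_collect_sigma)
    have "indep_sets ?E {1..}" using indep_U by (simp add: indep_vars_def2)
    then show "indep_sets ?E (\<Union>j\<in>UNIV. ?I j)"
      by (rule indep_sets_mono_index[rotated]) (auto split: bool.splits)
    show "disjoint_family ?I"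
      by (auto simp: disjoint_family_on_def split: bool.splits)
    fix i show "Int_stable (?E i)"
    proof (rule Int_stableI, clarify)
      fix A B :: "real set" assume "A \<in> sets borel" "B \<in> sets borel"
      then show "\<exists>C. U i -` A \<inter> space M \<inter> (U i -` B \<inter> space M) = U i -` C \<inter> space M \<and> C \<in> sets borel"
        by (intro exI[of _ "A \<inter> B"]) auto
    qed
  qed
  then have "indep_sets (case_bool (sets (F n)) (?E (Suc n))) UNIV"
    by (rule indep_sets_mono_sets) (auto simp: sets_F split: bool.splits)
  then show ?thesis by (simp add: indep_set_def)
qed

text \<open>The weak form of the fact that \<open>up n\<close> has conditional expectation
  \<open>X n\<close> given \<open>F n\<close>; every later conditioning argument rests on
  it.\<close>

lemma integral_up:
  assumes "D \<in> borel_measurable (F n)" "\<And>\<omega>. \<bar>D \<omega>\<bar> \<le> B"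
  shows "(\<integral>\<omega>. D \<omega> * up n \<omega> \<partial>M) = (\<integral>\<omega>. D \<omega> * X n \<omega> \<partial>M)"
  unfolding up_def
  by (rule integral_uniform_le[OF subalgebra_F measurable_U indep_F_U distr_U measurable_X_F])
    (use assms X_pos X_less_1 in \<open>auto intro: less_imp_le\<close>)

text \<open>The other arm, by subtracting \<open>integral_up\<close> from the integral of
  \<open>D\<close>; boundedness of \<open>D\<close> justifies splitting the integrals.\<close>

lemma integral_down:
  assumes D: "D \<in> borel_measurable (F n)" "\<And>\<omega>. \<bar>D \<omega>\<bar> \<le> B"
  shows "(\<integral>\<omega>. D \<omega> * (1 - up n \<omega>) \<partial>M) = (\<integral>\<omega>. D \<omega> * (1 - X n \<omega>) \<partial>M)"
proof -
  have [measurable]: "D \<in> borel_measurable M" "up n \<in> borel_measurable M" "X n \<in> borel_measurable M"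
    using measurable_F_M D measurable_up_F measurable_X_F by blast+
  have le: "\<bar>D \<omega> * p\<bar> \<le> B" if "0 \<le> p" "p \<le> 1" for \<omega> p
    using mult_mono[of "\<bar>D \<omega>\<bar>" B p 1] D(2)[of \<omega>] that by (auto simp: abs_mult)
  have "integrable M D" "integrable M (\<lambda>\<omega>. D \<omega> * up n \<omega>)" "integrable M (\<lambda>\<omega>. D \<omega> * X n \<omega>)"
    using D(2) X_pos[THEN less_imp_le] X_less_1[THEN less_imp_le]
    by (auto intro!: bounded_integrable[where B=B] le) (auto simp: up_def)
  then show ?thesis using integral_up[OF D] by (simp add: right_diff_distrib)
qed

text \<open>Stated for an abstract total weight \<open>Y\<close> of one arm, to be used for both arms.\<close>

lemma AE_summable_weight:
  fixes Y P J :: "nat \<Rightarrow> 'a \<Rightarrow> real"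
  assumes Y_0: "0 < b" "\<And>\<omega>. Y 0 \<omega> = b"
    and YF: "\<And>n. Y n \<in> borel_measurable (F n)"
    and Y_Suc: "\<And>n \<omega>. Y (Suc n) \<omega> = Y n \<omega> + \<Delta> (Suc n) * J n \<omega>"
    and J: "\<And>n \<omega>. J n \<omega> \<in> {0, 1}"
    and Y: "\<And>n \<omega>. Y n \<omega> = S n * P n \<omega>"
    and EJ: "\<And>n D B. D \<in> borel_measurable (F n) \<Longrightarrow> (\<And>\<omega>. \<bar>D \<omega>\<bar> \<le> B) \<Longrightarrow>
      (\<integral>\<omega>. D \<omega> * J n \<omega> \<partial>M) = (\<integral>\<omega>. D \<omega> * P n \<omega> \<partial>M)"
  shows "AE \<omega> in M. summable (\<lambda>n. \<Delta> (Suc n) / (S n * Y n \<omega>))"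
proof (rule AE_summable_if_integral_bounded)
  have mono: "Y n \<omega> \<le> Y (Suc n) \<omega>" and step: "Y (Suc n) \<omega> - Y n \<omega> \<le> C" for n \<omega>
    using J[of n \<omega>] weight_pos[of "Suc n"] weight_le[of "Suc n"] C_nonneg by (auto simp: Y_Suc)
  have ge: "b \<le> Y n \<omega>" for n \<omega>
    using lift_Suc_mono_le[of "\<lambda>n. Y n \<omega>", OF mono, of 0 n] by (simp add: Y_0)
  then have pos: "0 < Y n \<omega>" for n \<omega> using Y_0(1) by (rule less_le_trans[rotated])
  have [measurable]: "Y n \<in> borel_measurable M" for n by (rule measurable_F_M[OF YF])
  show nonneg: "0 \<le> \<Delta> (Suc n) / (S n * Y n \<omega>)" for n \<omega>
    using weight_pos[of "Suc n"] S_pos[of n] pos[of n \<omega>] by simp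
  show int: "integrable M (\<lambda>\<omega>. \<Delta> (Suc n) / (S n * Y n \<omega>))" for n
  proof (rule bounded_integrable[where B="\<Delta> (Suc n) / (S n * b)"])
    show "\<bar>\<Delta> (Suc n) / (S n * Y n \<omega>)\<bar> \<le> \<Delta> (Suc n) / (S n * b)" for \<omega>
      unfolding abs_of_nonneg[OF nonneg] using weight_pos[of "Suc n"] S_pos[of n] Y_0 ge[of n \<omega>]
      by (intro divide_left_mono mult_left_mono) (auto intro!: mult_pos_pos pos)
  qed measurable
  have D_le: "\<bar>\<Delta> (Suc n) / (Y n \<omega>)\<^sup>2\<bar> \<le> \<Delta> (Suc n) / b\<^sup>2" for n \<omega>
    using weight_pos[of "Suc n"] Y_0(1) ge[of n \<omega>] pos[of n \<omega>]
    by (auto simp: abs_mult intro!: divide_left_mono power_mono mult_pos_pos)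
  \<comment> \<open>Since \<open>Y n = S n * P n\<close>, the integrand is \<open>P n\<close> times
    a bounded \<open>F n\<close>-measurable factor. \<open>EJ\<close> exchanges \<open>P n\<close>
    for \<open>J n\<close>, and \<open>\<Delta> (Suc n) * J n\<close> is the increment of
    \<open>Y\<close>.\<close>
  have eq: "(\<integral>\<omega>. \<Delta> (Suc n) / (S n * Y n \<omega>) \<partial>M) = (\<integral>\<omega>. (Y (Suc n) \<omega> - Y n \<omega>) / (Y n \<omega>)\<^sup>2 \<partial>M)" for n
  proof -
    have "\<Delta> (Suc n) / (S n * Y n \<omega>) = \<Delta> (Suc n) / (Y n \<omega>)\<^sup>2 * P n \<omega>" for \<omega>
      using pos[of n \<omega>] S_pos[of n] by (simp add: Y power2_eq_square)
    then have "(\<integral>\<omega>. \<Delta> (Suc n) / (S n * Y n \<omega>) \<partial>M) = (\<integral>\<omega>. \<Delta> (Suc n) / (Y n \<omega>)\<^sup>2 * P n \<omega> \<partial>M)"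
      by simp
    also have "\<dots> = (\<integral>\<omega>. \<Delta> (Suc n) / (Y n \<omega>)\<^sup>2 * J n \<omega> \<partial>M)"
      by (intro EJ[symmetric, OF borel_measurable_divide[OF borel_measurable_const borel_measurable_power[OF YF]] D_le])
    finally show ?thesis by (simp add: Y_Suc)
  qed
  have int': "integrable M (\<lambda>\<omega>. (Y (Suc n) \<omega> - Y n \<omega>) / (Y n \<omega>)\<^sup>2)" for n
  proof (rule bounded_integrable[where B="\<Delta> (Suc n) / b\<^sup>2"])
    show "\<bar>(Y (Suc n) \<omega> - Y n \<omega>) / (Y n \<omega>)\<^sup>2\<bar> \<le> \<Delta> (Suc n) / b\<^sup>2" for \<omega>
      using D_le[of n \<omega>] J[of n \<omega>] weight_pos[of "Suc n"] by (auto simp: Y_Suc)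
  qed measurable
  \<comment> \<open>The telescoping bound holds on every path and depends only on \<open>b\<close>
    and \<open>C\<close>, so it passes to expectations.\<close>
  show "(\<Sum>k<n. \<integral>\<omega>. \<Delta> (Suc k) / (S k * Y k \<omega>) \<partial>M) \<le> (1 + C / b) / b" for n
  proof -
    have "(\<Sum>k<n. \<integral>\<omega>. \<Delta> (Suc k) / (S k * Y k \<omega>) \<partial>M) =
        (\<integral>\<omega>. (\<Sum>k<n. (Y (Suc k) \<omega> - Y k \<omega>) / (Y k \<omega>)\<^sup>2) \<partial>M)"
      unfolding eq using int' by (simp add: Bochner_Integration.integral_sum)
    also have "\<dots> \<le> (\<integral>\<omega>. (1 + C / b) / b \<partial>M)"
    proof (rule integral_mono)
      show "(\<Sum>k<n. (Y (Suc k) \<omega> - Y k \<omega>) / (Y k \<omega>)\<^sup>2) \<le> (1 + C / b) / b" for \<omega>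
        using sum_increment_div_square_le[of "\<lambda>n. Y n \<omega>" C n] mono step Y_0 by simp
    qed (use int' in auto)
    finally show ?thesis by (simp add: prob_space)
  qed
qed

section \<open>Doob decomposition of the log-odds\<close>

text \<open>The growth of the logarithm of \<open>S n * X n\<close> if its arm is chosen. The
  log-odds change by \<open>jump_up\<close> or by minus \<open>jump_down\<close>, both determined by
  \<open>X n\<close>.\<close>

definition jump_up :: "nat \<Rightarrow> 'a \<Rightarrow> real" where
  "jump_up n \<omega> = ln (1 + \<Delta> (Suc n) / (S n * X n \<omega>))"

definition jump_down :: "nat \<Rightarrow> 'a \<Rightarrow> real" where
  "jump_down n \<omega> = ln (1 + \<Delta> (Suc n) / (S n * (1 - X n \<omega>)))"

definition logit :: "nat \<Rightarrow> 'a \<Rightarrow> real" where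
  "logit n \<omega> = ln (X n \<omega> / (1 - X n \<omega>))"

text \<open>The conditional expectation of the log-odds increment given \<open>F n\<close>.\<close>

definition drift :: "nat \<Rightarrow> 'a \<Rightarrow> real" where
  "drift n \<omega> = X n \<omega> * jump_up n \<omega> - (1 - X n \<omega>) * jump_down n \<omega>"

text \<open>The two possible increments of the log-odds differ by
  \<open>jump_up + jump_down\<close>, so centering the increment leaves this sum times the centered
  choice.\<close>

definition mart :: "nat \<Rightarrow> 'a \<Rightarrow> real" where
  "mart n \<omega> = (\<Sum>k<n. (up k \<omega> - X k \<omega>) * (jump_up k \<omega> + jump_down k \<omega>))"

text \<open>\<open>S n\<close> cancels in the odds, so the log-odds are the difference of the
  logarithms of the two arm weights, of which exactly one grows.\<close>

lemma logit_Suc: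
  "logit (Suc n) \<omega> - logit n \<omega> = (up n \<omega> - X n \<omega>) * (jump_up n \<omega> + jump_down n \<omega>) + drift n \<omega>"
proof -
  have odds: "logit n \<omega> = ln (S n * X n \<omega>) - ln (S n * (1 - X n \<omega>))" for n
    using S_pos[of n] X_pos[of n \<omega>] X_less_1[of n \<omega>]
    by (simp add: logit_def ln_div ln_mult)
  let ?y = "S n * X n \<omega>" and ?z = "S n * (1 - X n \<omega>)"
  have pos: "0 < ?y" "0 < ?z" "0 < \<Delta> (Suc n)"
    using S_pos[of n] X_pos[of n \<omega>] X_less_1[of n \<omega>] weight_pos[of "Suc n"] by auto
  have jump: "ln (1 + d / y) = ln (y + d) - ln y" if "0 < y" "0 < d" for d y :: real
  proof -
    have "1 + d / y = (y + d) / y" using that by (simp add: field_simps)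
    then show ?thesis using that by (simp add: ln_div)
  qed
  have "logit (Suc n) \<omega> - logit n \<omega> = up n \<omega> * jump_up n \<omega> - (1 - up n \<omega>) * jump_down n \<omega>"
    unfolding odds S_X_Suc S_X_Suc' jump_up_def jump_down_def
      jump[OF pos(1,3)] jump[OF pos(2,3)] by (simp add: up_def)
  then show ?thesis by (simp add: drift_def algebra_simps)
qed

lemma logit_eq: "logit n \<omega> = mart n \<omega> + (logit 0 \<omega> + (\<Sum>k<n. drift k \<omega>))"
proof (induction n)
  case (Suc n)
  then show ?case using logit_Suc[of n \<omega>] by (simp add: mart_def)
qed (simp add: mart_def)

text \<open>Both terms of the drift have leading part \<open>\<Delta> (Suc n) / S n\<close>, which
  cancels; what remains is one second-order error per arm.\<close>

lemma abs_drift_le: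
  "\<bar>drift n \<omega>\<bar> \<le> C * (\<Delta> (Suc n) / (S n * (S n * X n \<omega>))) +
     C * (\<Delta> (Suc n) / (S n * (S n * (1 - X n \<omega>))))"
proof -
  let ?r = "\<lambda>p. C * (\<Delta> (Suc n) / (S n * (S n * p)))"
  have p: "0 < X n \<omega>" "0 < 1 - X n \<omega>" using X_pos X_less_1 by auto
  have d: "0 \<le> \<Delta> (Suc n)" "\<Delta> (Suc n) \<le> C" using weight_pos weight_le by (auto intro: less_imp_le)
  have "0 \<le> ?r (X n \<omega>)" "0 \<le> ?r (1 - X n \<omega>)"
    using C_nonneg d S_pos[of n] p by (auto intro!: mult_nonneg_nonneg divide_nonneg_nonneg)
  then show ?thesis
    using scaled_ln_bounds[OF p(1) S_pos[of n] d] scaled_ln_bounds[OF p(2) S_pos[of n] d]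
    unfolding drift_def jump_up_def jump_down_def by linarith
qed

lemma AE_summable_drift: "AE \<omega> in M. summable (\<lambda>n. \<bar>drift n \<omega>\<bar>)"
proof -
  have [measurable]: "X n \<in> borel_measurable (F n)" for n by (rule measurable_X_F)
  have "AE \<omega> in M. summable (\<lambda>n. \<Delta> (Suc n) / (S n * (S n * X n \<omega>)))"
  proof (rule AE_summable_weight[where b=x and P=X and J=up, OF _ _ _ S_X_Suc _ refl integral_up])
    show "0 < x" using start by simp
  qed (simp_all add: S_0 up_def del: bandit.simps(2))
  moreover have "AE \<omega> in M. summable (\<lambda>n. \<Delta> (Suc n) / (S n * (S n * (1 - X n \<omega>))))"
  proof (rule AE_summable_weight[where b="1 - x" and P="\<lambda>n \<omega>. 1 - X n \<omega>" and J="\<lambda>n \<omega>. 1 - up n \<omega>",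
        OF _ _ _ S_X_Suc' _ refl integral_down])
    show "0 < 1 - x" using start by simp
  qed (simp_all add: S_0 up_def del: bandit.simps(2))
  ultimately show ?thesis
  proof eventually_elim
    case (elim \<omega>)
    show ?case
      by (rule summable_comparison_test'[OF summable_add[OF elim(1)[THEN summable_mult, of C] elim(2)[THEN summable_mult, of C]]])
        (use abs_drift_le in simp)
  qed
qed

text \<open>Obtained from the lower bounds \<open>x\<close> and \<open>1 - x\<close> of the arm
  weights, so it is deterministic and depends only on \<open>x\<close> and \<open>C\<close>.\<close>

definition jump_bound :: real where
  "jump_bound = ln (1 + C / x) + ln (1 + C / (1 - x))"

lemma jump_sum_bounds: "0 \<le> jump_up n \<omega> + jump_down n \<omega>" "jump_up n \<omega> + jump_down n \<omega> \<le> jump_bound"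
proof -
  have *: "0 \<le> ln (1 + \<Delta> (Suc n) / y) \<and> ln (1 + \<Delta> (Suc n) / y) \<le> ln (1 + C / y0)"
    if "0 < y0" "y0 \<le> y" for y0 y
  proof -
    have "0 < \<Delta> (Suc n)" "\<Delta> (Suc n) \<le> C" using weight_pos weight_le by auto
    then have "0 \<le> \<Delta> (Suc n) / y" "\<Delta> (Suc n) / y \<le> C / y0" using that by (auto intro: frac_le)
    then show ?thesis by simp
  qed
  show "0 \<le> jump_up n \<omega> + jump_down n \<omega>" "jump_up n \<omega> + jump_down n \<omega> \<le> jump_bound"
    using *[OF _ S_X_ge[of n \<omega>]] *[OF _ S_X_ge'[of n \<omega>]] start
    by (auto simp: jump_up_def jump_down_def jump_bound_def)
qed

lemma abs_mart_step_le: "\<bar>mart (Suc n) \<omega> - mart n \<omega>\<bar> \<le> jump_bound"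
proof -
  have "\<bar>up n \<omega> - X n \<omega>\<bar> \<le> 1" using X_pos[of n \<omega>] X_less_1[of n \<omega>] by (auto simp: up_def)
  then have "\<bar>up n \<omega> - X n \<omega>\<bar> * (jump_up n \<omega> + jump_down n \<omega>) \<le> 1 * jump_bound"
    using jump_sum_bounds[of n \<omega>] by (intro mult_mono) auto
  then show ?thesis
    using jump_sum_bounds(1)[of n \<omega>] by (simp add: mart_def abs_mult)
qed

lemma measurable_jump_F: "(\<lambda>\<omega>. jump_up n \<omega> + jump_down n \<omega>) \<in> borel_measurable (F n)"
  using measurable_X_F[of n] unfolding jump_up_def jump_down_def by measurable

lemma measurable_mart_F: "mart n \<in> borel_measurable (F n)"
proof -
  have "(\<lambda>\<omega>. (up k \<omega> - X k \<omega>) * (jump_up k \<omega> + jump_down k \<omega>)) \<in> borel_measurable (F n)" if "k < n" for k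
  proof -
    have "up k \<in> borel_measurable (F n)" using that by (intro F_mono[OF _ measurable_up_F]) auto
    moreover have "X k \<in> borel_measurable (F n)" using that by (intro F_mono[OF _ measurable_X_F]) auto
    moreover have "(\<lambda>\<omega>. jump_up k \<omega> + jump_down k \<omega>) \<in> borel_measurable (F n)"
      using that by (intro F_mono[OF _ measurable_jump_F]) auto
    ultimately show ?thesis by measurable
  qed
  then show ?thesis unfolding mart_def by (intro borel_measurable_sum) auto
qed

lemma integrable_mart: "integrable M (mart n)"
proof (rule bounded_integrable)
  show "\<bar>mart n \<omega>\<bar> \<le> real n * jump_bound" for \<omega>
  proof (induction n)
    case (Suc n)
    then show ?case using abs_mart_step_le[of n \<omega>] by (simp add: algebra_simps)
  qed (simp add: mart_def)
qed (rule measurable_F_M[OF measurable_mart_F])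

text \<open>Each increment is \<open>up n - X n\<close> times a bounded
  \<open>F n\<close>-measurable factor, so \<open>integral_up\<close> makes its integral over any
  set of \<open>F n\<close> vanish. The starting time is left free: 1 serves the existence claim, 0
  the exclusion of limits.\<close>

lemma martingale_mart: "martingale_from M F m mart"
proof -
  have "AE \<omega> in M. real_cond_exp M (F n) (mart (Suc n)) \<omega> = mart n \<omega>" for n
  proof -
    interpret finite_measure_subalgebra M "F n" by unfold_locales (rule subalgebra_F)
    show ?thesis
    proof (rule real_cond_exp_charact)
      fix A assume A: "A \<in> sets (F n)"
      \<comment> \<open>The jump size cut off to \<open>A\<close> is the test function for
        \<open>integral_up\<close>.\<close>
      define D where "D \<omega> = indicator A \<omega> * (jump_up n \<omega> + jump_down n \<omega>)" for \<omega>
      have DF: "D \<in> borel_measurable (F n)"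
        using A measurable_jump_F unfolding D_def by measurable
      have D_le: "\<bar>D \<omega>\<bar> \<le> jump_bound" for \<omega>
        using jump_sum_bounds[of n \<omega>] by (auto simp: D_def indicator_def)
      have [measurable]: "D \<in> borel_measurable M" "up n \<in> borel_measurable M" "X n \<in> borel_measurable M"
        using measurable_F_M DF measurable_up_F measurable_X_F by blast+
      have le: "\<bar>D \<omega> * p\<bar> \<le> jump_bound" if "0 \<le> p" "p \<le> 1" for \<omega> p
        using mult_mono[of "\<bar>D \<omega>\<bar>" jump_bound p 1] D_le[of \<omega>] that by (auto simp: abs_mult)
      have int: "integrable M (\<lambda>\<omega>. D \<omega> * up n \<omega>)" "integrable M (\<lambda>\<omega>. D \<omega> * X n \<omega>)"
        using X_pos[THEN less_imp_le] X_less_1[THEN less_imp_le]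
        by (auto intro!: bounded_integrable[where B=jump_bound] le) (auto simp: up_def)
      have AM: "A \<in> events" using A subalgebra_F[of n] by (auto simp: subalgebra_def)
      have int_A: "integrable M (\<lambda>\<omega>. indicator A \<omega> * mart n \<omega>)"
        using integrable_mult_indicator[OF AM integrable_mart[of n]] by simp
      have "(\<integral>\<omega>\<in>A. mart (Suc n) \<omega> \<partial>M) =
          (\<integral>\<omega>. indicator A \<omega> * mart n \<omega> + (D \<omega> * up n \<omega> - D \<omega> * X n \<omega>) \<partial>M)"
        unfolding set_lebesgue_integral_def
        by (intro Bochner_Integration.integral_cong) (auto simp: mart_def D_def algebra_simps)
      also have "\<dots> = (\<integral>\<omega>\<in>A. mart n \<omega> \<partial>M)"
        using int int_A integral_up[OF DF D_le] by (simp add: set_lebesgue_integral_def)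
      finally show "(\<integral>\<omega>\<in>A. mart (Suc n) \<omega> \<partial>M) = (\<integral>\<omega>\<in>A. mart n \<omega> \<partial>M)" .
    qed (auto intro: integrable_mart measurable_mart_F)
  qed
  then show ?thesis
    by (auto simp: martingale_from_def filtration_F subalgebra_F measurable_mart_F integrable_mart)
qed

text \<open>The difference is the initial log-odds plus a partial sum of the drift, which is almost
  surely absolutely summable; \<open>c\<close> depends on the path.\<close>

lemma AE_logit_mart_bounded: "AE \<omega> in M. \<exists>c. \<forall>n. \<bar>logit n \<omega> - mart n \<omega>\<bar> \<le> c"
  using AE_summable_drift
proof eventually_elim
  case (elim \<omega>)
  have "\<bar>logit n \<omega> - mart n \<omega>\<bar> \<le> \<bar>logit 0 \<omega>\<bar> + (\<Sum>k. \<bar>drift k \<omega>\<bar>)" for n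
  proof -
    have "\<bar>\<Sum>k<n. drift k \<omega>\<bar> \<le> (\<Sum>k<n. \<bar>drift k \<omega>\<bar>)" by (rule sum_abs)
    also have "\<dots> \<le> (\<Sum>k. \<bar>drift k \<omega>\<bar>)" by (rule sum_le_suminf[OF elim]) auto
    finally show ?thesis by (simp add: logit_eq[of n])
  qed
  then show ?case by blast
qed

section \<open>Excluding the limits 0 and 1\<close>

text \<open>At bounded distance from \<open>mart\<close>, the log-odds cannot diverge unless
  \<open>mart\<close> does.\<close>

lemma AE_logit_not_at_bot: "AE \<omega> in M. \<not> filterlim (\<lambda>n. logit n \<omega>) at_bot sequentially"
proof -
  have "AE \<omega> in M. \<not> filterlim (\<lambda>n. mart n \<omega>) at_bot sequentially"
    using abs_mart_step_le by (intro AE_not_martingale_at_bot[OF prob_space_axioms martingale_mart[of 0]]) auto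
  then show ?thesis using AE_logit_mart_bounded
  proof eventually_elim
    case (elim \<omega>)
    then obtain c where c: "\<And>n. \<bar>logit n \<omega> - mart n \<omega>\<bar> \<le> c" by blast
    show ?case
    proof
      assume "filterlim (\<lambda>n. logit n \<omega>) at_bot sequentially"
      then have "filterlim (\<lambda>n. - c + - logit n \<omega>) at_top sequentially"
        by (intro filterlim_tendsto_add_at_top[OF tendsto_const]) (simp add: filterlim_uminus_at_bot)
      moreover have "- c + - logit n \<omega> \<le> - mart n \<omega>" for n using c[of n] by linarith
      ultimately have "filterlim (\<lambda>n. - mart n \<omega>) at_top sequentially"
        by (auto intro: filterlim_at_top_mono)
      then have "filterlim (\<lambda>n. mart n \<omega>) at_bot sequentially"
        by (simp add: filterlim_uminus_at_bot)
      then show False using elim by blast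
    qed
  qed
qed

lemma AE_logit_not_at_top: "AE \<omega> in M. \<not> filterlim (\<lambda>n. logit n \<omega>) at_top sequentially"
proof -
  have "AE \<omega> in M. \<not> filterlim (\<lambda>n. - mart n \<omega>) at_bot sequentially"
    using abs_mart_step_le
    by (intro AE_not_martingale_at_bot[OF prob_space_axioms martingale_from_uminus[OF prob_space_axioms martingale_mart[of 0]],
          where K=jump_bound]) (auto simp: abs_minus_commute)
  then show ?thesis using AE_logit_mart_bounded
  proof eventually_elim
    case (elim \<omega>)
    then obtain c where c: "\<And>n. \<bar>logit n \<omega> - mart n \<omega>\<bar> \<le> c" by blast
    show ?case
    proof
      assume "filterlim (\<lambda>n. logit n \<omega>) at_top sequentially"
      then have "filterlim (\<lambda>n. - c + logit n \<omega>) at_top sequentially"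
        by (rule filterlim_tendsto_add_at_top[OF tendsto_const])
      moreover have "- c + logit n \<omega> \<le> mart n \<omega>" for n using c[of n] by linarith
      ultimately have "filterlim (\<lambda>n. mart n \<omega>) at_top sequentially"
        by (auto intro: filterlim_at_top_mono)
      then have "filterlim (\<lambda>n. - mart n \<omega>) at_bot sequentially"
        by (simp add: filterlim_uminus_at_top)
      then show False using elim by blast
    qed
  qed
qed

text \<open>If \<open>X\<close> tended to 0, the positive odds would tend to 0 from the right and
  their logarithm to minus infinity.\<close>

lemma AE_not_tendsto_0: "AE \<omega> in M. \<not> (\<lambda>n. X n \<omega>) \<longlonglongrightarrow> 0"
  using AE_logit_not_at_bot
proof eventually_elim
  case (elim \<omega>)
  show ?case
  proof
    assume lim: "(\<lambda>n. X n \<omega>) \<longlonglongrightarrow> 0"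
    then have "(\<lambda>n. X n \<omega> / (1 - X n \<omega>)) \<longlonglongrightarrow> 0 / (1 - 0)" by (intro tendsto_intros) auto
    then have "filterlim (\<lambda>n. X n \<omega> / (1 - X n \<omega>)) (at_right 0) sequentially"
      using X_pos[of _ \<omega>] X_less_1[of _ \<omega>] by (auto simp: tendsto_imp_filterlim_at_right)
    then show False using elim filterlim_compose[OF ln_at_0] unfolding logit_def by blast
  qed
qed

lemma AE_not_tendsto_1: "AE \<omega> in M. \<not> (\<lambda>n. X n \<omega>) \<longlonglongrightarrow> 1"
  using AE_logit_not_at_top
proof eventually_elim
  case (elim \<omega>)
  show ?case
  proof
    assume lim: "(\<lambda>n. X n \<omega>) \<longlonglongrightarrow> 1"
    then have "(\<lambda>n. 1 - X n \<omega>) \<longlonglongrightarrow> 1 - 1" by (intro tendsto_intros)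
    then have "filterlim (\<lambda>n. 1 - X n \<omega>) (at_right 0) sequentially"
      using X_less_1[of _ \<omega>] by (auto simp: tendsto_imp_filterlim_at_right)
    then have "filterlim (\<lambda>n. X n \<omega> / (1 - X n \<omega>)) at_top sequentially"
      using X_less_1[of _ \<omega>] by (intro LIM_at_top_divide[OF lim]) (auto simp: filterlim_at)
    then show False using elim filterlim_compose[OF ln_at_top] unfolding logit_def by blast
  qed
qed

end

theorem proposition7:
  fixes M :: "'a measure"
    and U :: "nat \<Rightarrow> 'a \<Rightarrow> real"
    and \<Delta> :: "nat \<Rightarrow> real"
  assumes "prob_space M"
    and "prob_space.indep_vars M (\<lambda>_. borel) U {1..}"
    and "\<And>n. n \<ge> 1 \<Longrightarrow> distr M borel (U n) = uniform_measure lborel {0..1}"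
    and "\<Delta> 0 = 1"
    and "\<And>n. n \<ge> 1 \<Longrightarrow> \<Delta> n > 0"
    and "\<not> summable (\<lambda>n. bandit_step \<Delta> (Suc n))"
    and "bounded (\<Delta> ` {1..})"
  shows "(\<forall>x\<in>{0<..<1}. \<exists>N. martingale_from M (natural_filtration M U) 1 N \<and>
            (\<exists>K. AE \<omega> in M. \<forall>n\<ge>1. \<bar>N (Suc n) \<omega> - N n \<omega>\<bar> \<le> K) \<and>
            (AE \<omega> in M. bdd_above ((\<lambda>n.
                \<bar>ln (bandit (bandit_step \<Delta>) U x n \<omega> 
                    / (1 - bandit (bandit_step \<Delta>) U x n \<omega>)) - N n \<omega>\<bar>) ` {1..})))
       \<and> (\<forall>x\<in>{0<..<1}. \<forall>Xinf\<in>borel_measurable M.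
            (AE \<omega> in M. (\<lambda>n. bandit (bandit_step \<Delta>) U x n \<omega>) \<longlonglongrightarrow> Xinf \<omega>) \<longrightarrow>
            measure M {\<omega> \<in> space M. Xinf \<omega> = 0} = 0 \<and>
            measure M {\<omega> \<in> space M. Xinf \<omega> = 1} = 0)"
proof -
  \<comment> \<open>The weights are positive, so an upper bound captures boundedness.\<close>
  obtain C where C: "\<And>n. n \<ge> 1 \<Longrightarrow> \<Delta> n \<le> C"
    using bounded_imp_bdd_above[OF assms(7)] by (auto simp: bdd_above_def)
  have bandit: "two_armed_bandit M U \<Delta> x C" if "x \<in> {0<..<1}" for x
    using assms(1-5) C that by (simp add: two_armed_bandit_def two_armed_bandit_axioms_def)
  show ?thesis
  \<comment> \<open>The pattern confines \<open>conjI\<close> to the outer conjunction, so the inner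
    ones stay whole.\<close>
  proof (intro conjI[of "\<forall>x\<in>_. _ x"] ballI impI)
    fix x :: real assume "x \<in> {0<..<1}"
    then interpret two_armed_bandit M U \<Delta> x C by (rule bandit)
    show "\<exists>N. martingale_from M F 1 N \<and>
            (\<exists>K. AE \<omega> in M. \<forall>n\<ge>1. \<bar>N (Suc n) \<omega> - N n \<omega>\<bar> \<le> K) \<and>
            (AE \<omega> in M. bdd_above ((\<lambda>n. \<bar>ln (X n \<omega> / (1 - X n \<omega>)) - N n \<omega>\<bar>) ` {1..}))"
    proof (intro exI conjI)
      show "martingale_from M F 1 mart" by (rule martingale_mart)
      show "AE \<omega> in M. \<forall>n\<ge>1. \<bar>mart (Suc n) \<omega> - mart n \<omega>\<bar> \<le> jump_bound"
        using abs_mart_step_le by simp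
      show "AE \<omega> in M. bdd_above ((\<lambda>n. \<bar>ln (X n \<omega> / (1 - X n \<omega>)) - mart n \<omega>\<bar>) ` {1..})"
        using AE_logit_mart_bounded
      proof eventually_elim
        case (elim \<omega>)
        then obtain c where "\<And>n. \<bar>logit n \<omega> - mart n \<omega>\<bar> \<le> c" by blast
        then show ?case unfolding logit_def by (rule bdd_aboveI2)
      qed
    qed
  next
    fix x :: real and Xinf :: "'a \<Rightarrow> real"
    assume "x \<in> {0<..<1}"
    then interpret two_armed_bandit M U \<Delta> x C by (rule bandit)
    assume [measurable]: "Xinf \<in> borel_measurable M" and lim: "AE \<omega> in M. (\<lambda>n. X n \<omega>) \<longlonglongrightarrow> Xinf \<omega>"
    \<comment> \<open>On almost every path \<open>Xinf\<close> is the limit of \<open>X\<close>, so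
      the value 0 would mean convergence to 0.\<close>
    have "AE \<omega> in M. Xinf \<omega> \<noteq> 0" using lim AE_not_tendsto_0 by eventually_elim auto
    then have "prob {\<omega> \<in> space M. Xinf \<omega> = 0} = 0"
      by (subst prob_eq_0) auto
    moreover have "AE \<omega> in M. Xinf \<omega> \<noteq> 1" using lim AE_not_tendsto_1 by eventually_elim auto
    then have "prob {\<omega> \<in> space M. Xinf \<omega> = 1} = 0"
      by (subst prob_eq_0) auto
    ultimately show "prob {\<omega> \<in> space M. Xinf \<omega> = 0} = 0 \<and> prob {\<omega> \<in> space M. Xinf \<omega> = 1} = 0" ..
  qed
qed

end
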